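(* Let $n\ge2$ and let $F:\mathbb{R}^n\to\mathbb{R}$ be $C^\infty$ on $\mathbb{R}^n-\{0\}$, continuous on $\mathbb{R}^n$, positively homogeneous, and suppose that its Hessian is non-negative in the sense that for every $y\in\mathbb{R}^n-\{0\}$ and every $w\in\mathbb{R}^n$ $$w^iw^j\frac{\partial^2F}{\partial y^i\partial y^j}(y)\ge0.$$ Then for all $y_1,y_2\in\mathbb{R}^n$ $$F(y_1)+F(y_2)\ge F(y_1+y_2)\quad\text{(the triangle inequality)};$$ and for all $y,z\in\mathbb{R}^n$ with $y\ne0$ $$F(z)\ge z^i\frac{\partial F}{\partial y^i}(y)\quad\text{(the fundamental inequality)}.$$
   Context: Summation over repeated indices is understood. Positively homogeneous means $F(ky)=kF(y)$ for all $k>0$. No sign assumption is made on $F$. *)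

theory Defs
  imports "HOL-Analysis.Analysis"
begin

definition partial_deriv :: "'n \<Rightarrow> (real ^ 'n \<Rightarrow> real) \<Rightarrow> real ^ 'n \<Rightarrow> real" where
  "partial_deriv i f x = deriv (\<lambda>t. f (x + t *\<^sub>R axis i 1)) 0"

text \<open>
  \<open>f\<close> is \<open>C\<^sup>\<infinity>\<close> on \<open>S\<close>, where \<open>S\<close> is meant to be open: every iterated partial derivative of
  \<open>f\<close>, of any order and in any sequence of directions, is continuous on \<open>S\<close> and has again
  all its partial derivatives at every point of \<open>S\<close>. The existence clause is needed because
  \<^const>\<open>deriv\<close> is total. In the list \<open>[i, j]\<close> the last index is differentiated first.
\<close>

definition smooth_on :: "(real ^ 'n) set \<Rightarrow> (real ^ 'n \<Rightarrow> real) \<Rightarrow> bool" where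
  "smooth_on S f \<longleftrightarrow>
     (\<forall>is. continuous_on S (foldr partial_deriv is f) \<and>
       (\<forall>i. \<forall>x\<in>S. (\<lambda>t. foldr partial_deriv is f (x + t *\<^sub>R axis i 1))
                       field_differentiable at 0))"

definition pos_homogeneous :: "('a::real_vector \<Rightarrow> real) \<Rightarrow> bool" where
  "pos_homogeneous f \<longleftrightarrow> (\<forall>k>0. \<forall>y. f (k *\<^sub>R y) = k * f y)"

end

theory Submission
  imports Defs
begin

text \<open>
  Along a segment that avoids the origin the restriction of \<open>F\<close> is twice differentiable with
  non-negative second derivative, so \<open>F\<close> lies above its tangent there. Euler's identity
  \<open>y\<^sup>i \<partial>\<^sub>i F(y) = F(y)\<close> turns the tangent inequality into the fundamental inequality. If the
  segment from \<open>y\<close> to \<open>z\<close> meets the origin, then \<open>z\<close> is moved off the line through \<open>y\<close>, which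
  is possible as \<open>n \<ge> 2\<close>, and continuity of \<open>F\<close> gives the inequality in the limit. The triangle
  inequality is the sum of two fundamental inequalities at \<open>y = y\<^sub>1 + y\<^sub>2\<close>, or at \<open>y = y\<^sub>1\<close> if
  \<open>y\<^sub>1 + y\<^sub>2 = 0\<close>.
\<close>

section \<open>Smooth functions: from partial derivatives to the differential\<close>

lemma smooth_on_partial_deriv:
  assumes "smooth_on S f"
  shows "smooth_on S (partial_deriv i f)"
  unfolding smooth_on_def
proof
  fix js
  show "continuous_on S (foldr partial_deriv js (partial_deriv i f)) \<and>
      (\<forall>k. \<forall>x\<in>S. (\<lambda>t. foldr partial_deriv js (partial_deriv i f) (x + t *\<^sub>R axis k 1))
        field_differentiable at 0)"
    \<comment> \<open>\<open>foldr\<close> applies the last index first, so appending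
      \<open>i\<close> to \<open>js\<close> makes \<open>partial_deriv i\<close> innermost.\<close>
    using assms[unfolded smooth_on_def, rule_format, of "js @ [i]"] by simp
qed

lemma smooth_on_imp_continuous_on:
  assumes "smooth_on S f"
  shows "continuous_on S f"
  using assms[unfolded smooth_on_def, rule_format, of "[]"] by simp

text \<open>\<open>smooth_on\<close> yields derivatives at parameter 0 only. Moving the base point
  along the axis and shifting the parameter reaches every \<open>t\<close>, as the mean value
  argument requires.\<close>

lemma smooth_on_has_partial_deriv:
  assumes "smooth_on S f" and "x + t *\<^sub>R axis i 1 \<in> S"
  shows "((\<lambda>t. f (x + t *\<^sub>R axis i 1)) has_real_derivative
           partial_deriv i f (x + t *\<^sub>R axis i 1)) (at t)"
proof -
  have "((\<lambda>s. f ((x + t *\<^sub>R axis i 1) + s *\<^sub>R axis i 1)) has_real_derivative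
           partial_deriv i f (x + t *\<^sub>R axis i 1)) (at 0)"
    using assms(1)[unfolded smooth_on_def, rule_format, of "[]"] assms(2)
    by (simp add: partial_deriv_def DERIV_deriv_iff_field_differentiable)
  then have "((\<lambda>s. f (x + (s + t) *\<^sub>R axis i 1)) has_real_derivative
           partial_deriv i f (x + t *\<^sub>R axis i 1)) (at 0)"
    by (simp add: algebra_simps)
  then show ?thesis
    using DERIV_shift[of "\<lambda>t. f (x + t *\<^sub>R axis i 1)" _ 0 t] by simp
qed

text \<open>\<open>smooth_on\<close> speaks of coordinate directions alone, whereas the convexity
  argument moves along arbitrary lines. Continuity of the first partial derivatives bridges the
  gap.\<close>

lemma smooth_on_has_derivative:
  fixes f :: "real ^ 'n \<Rightarrow> real"
  assumes "open S" and sm: "smooth_on S f" and "x \<in> S"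
  shows "(f has_derivative (\<lambda>h. \<Sum>i\<in>UNIV. h $ i * partial_deriv i f x)) (at x)"
proof -
  \<comment> \<open>Admitting the coordinate directions one at a time reduces the claim to the mean value
    theorem in one variable.\<close>
  have approx: "\<forall>e>0. \<exists>d>0. \<forall>h. (\<forall>i. i \<notin> I \<longrightarrow> h $ i = 0) \<longrightarrow> norm h < d \<longrightarrow>
      \<bar>f (x + h) - f x - (\<Sum>i\<in>I. h $ i * partial_deriv i f x)\<bar> \<le> e * norm h"
    if "finite I" for I :: "'n set"
    using that
  proof induction
    case empty
    have "h = 0" if "\<forall>i. h $ i = 0" for h :: "real ^ 'n"
      using that by (simp add: vec_eq_iff)
    then show ?case
      by (force intro: exI[of _ 1])
  next
    case (insert j I)
    show ?case
    proof (intro allI impI)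
      fix e :: real
      assume "e > 0"
      then have e2: "e / 2 > 0" by simp
      obtain d1 where d1: "d1 > 0" "\<And>h. (\<forall>i. i \<notin> I \<longrightarrow> h $ i = 0) \<Longrightarrow> norm h < d1 \<Longrightarrow>
          \<bar>f (x + h) - f x - (\<Sum>i\<in>I. h $ i * partial_deriv i f x)\<bar> \<le> e / 2 * norm h"
        using insert.IH e2 by meson
      obtain d2 where d2: "d2 > 0" "\<And>y. dist y x < d2 \<Longrightarrow> y \<in> S"
        using assms(1,3) unfolding open_dist by blast
      have "isCont (partial_deriv j f) x"
        using smooth_on_imp_continuous_on[OF smooth_on_partial_deriv[OF sm]] assms(1,3)
        by (simp add: continuous_on_eq_continuous_at)
      then obtain d3 where d3: "d3 > 0"
        "\<And>y. dist y x < d3 \<Longrightarrow> \<bar>partial_deriv j f y - partial_deriv j f x\<bar> < e / 2"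
        using e2 unfolding continuous_at_eps_delta dist_real_def by meson
      define d where "d = min d1 (min d2 d3)"
      have "\<bar>f (x + h) - f x - (\<Sum>i\<in>insert j I. h $ i * partial_deriv i f x)\<bar> \<le> e * norm h"
        if supp: "\<forall>i. i \<notin> insert j I \<longrightarrow> h $ i = 0" and small: "norm h < d" for h
      proof -
        \<comment> \<open>The increment is split at \<open>x + h'\<close>, where the
          \<open>j\<close>-th coordinate is erased: the induction hypothesis covers the way from
          \<open>x\<close> to \<open>x + h'\<close>, the mean value theorem the way on to
          \<open>x + h\<close>. Each contributes an error of at most
          \<open>e / 2 * norm h\<close>.\<close>
        define h' where "h' = h - h $ j *\<^sub>R axis j 1"
        have h'_nth: "h' $ i = (if i = j then 0 else h $ i)" for i
          by (simp add: h'_def axis_def)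
        have near: "norm (h' + t *\<^sub>R axis j 1) \<le> norm h" if "\<bar>t\<bar> \<le> \<bar>h $ j\<bar>" for t
          using that by (intro norm_le_componentwise_cart) (auto simp: h'_nth axis_def)
        have near0: "norm h' \<le> norm h"
          using near[of 0] by simp
        \<comment> \<open>With the linear term subtracted, the derivative of \<open>\<phi>\<close>
          is a difference of values of \<open>partial_deriv j f\<close>, which continuity at
          \<open>x\<close> keeps below \<open>e / 2\<close>.\<close>
        define \<phi> where "\<phi> t = f ((x + h') + t *\<^sub>R axis j 1) - t * partial_deriv j f x" for t
        have bound: "norm (\<phi> (h $ j) - \<phi> 0) \<le> e / 2 * norm (h $ j - 0)"
        proof (rule field_differentiable_bound[where S = "closed_segment 0 (h $ j)"
              and f' = "\<lambda>t. partial_deriv j f ((x + h') + t *\<^sub>R axis j 1) - partial_deriv j f x"])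
          fix t
          assume "t \<in> closed_segment 0 (h $ j)"
          then have "\<bar>t\<bar> \<le> \<bar>h $ j\<bar>"
            by (auto simp: closed_segment_eq_real_ivl split: if_splits)
          then have "norm (h' + t *\<^sub>R axis j 1) < d"
            using near small by fastforce
          then have dist: "dist ((x + h') + t *\<^sub>R axis j 1) x < d"
            by (simp add: dist_norm add.assoc)
          have "((x + h') + t *\<^sub>R axis j 1) \<in> S"
            using dist by (intro d2(2)) (simp add: d_def)
          from smooth_on_has_partial_deriv[OF sm this]
          have "(\<phi> has_field_derivative
              partial_deriv j f ((x + h') + t *\<^sub>R axis j 1) - 1 * partial_deriv j f x) (at t)"
            unfolding \<phi>_def by (intro DERIV_diff DERIV_cmult_right DERIV_ident)
          then show "(\<phi> has_field_derivative
              partial_deriv j f ((x + h') + t *\<^sub>R axis j 1) - partial_deriv j f x)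
              (at t within closed_segment 0 (h $ j))"
            by (simp add: has_field_derivative_at_within)
          show "norm (partial_deriv j f ((x + h') + t *\<^sub>R axis j 1) - partial_deriv j f x) \<le> e / 2"
            using d3(2)[of "(x + h') + t *\<^sub>R axis j 1"] dist by (simp add: d_def)
        qed auto
        have "\<phi> (h $ j) - \<phi> 0 = f (x + h) - f (x + h') - h $ j * partial_deriv j f x"
          by (simp add: \<phi>_def h'_def)
        moreover have "e / 2 * \<bar>h $ j\<bar> \<le> e / 2 * norm h"
          using component_le_norm_cart[of h j] e2 by (intro mult_left_mono) auto
        ultimately have 1:
          "\<bar>f (x + h) - f (x + h') - h $ j * partial_deriv j f x\<bar> \<le> e / 2 * norm h"
          using bound by simp
        have "\<bar>f (x + h') - f x - (\<Sum>i\<in>I. h' $ i * partial_deriv i f x)\<bar> \<le> e / 2 * norm h'"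
          using near0 small supp by (intro d1(2)) (auto simp: h'_nth d_def)
        also have "\<dots> \<le> e / 2 * norm h"
          using near0 e2 by (intro mult_left_mono) auto
        also have "(\<Sum>i\<in>I. h' $ i * partial_deriv i f x) = (\<Sum>i\<in>I. h $ i * partial_deriv i f x)"
          using insert.hyps by (intro sum.cong) (auto simp: h'_nth)
        finally have 2:
          "\<bar>f (x + h') - f x - (\<Sum>i\<in>I. h $ i * partial_deriv i f x)\<bar> \<le> e / 2 * norm h" .
        have "(\<Sum>i\<in>insert j I. h $ i * partial_deriv i f x) =
            h $ j * partial_deriv j f x + (\<Sum>i\<in>I. h $ i * partial_deriv i f x)"
          using insert.hyps by simp
        with 1 2 show ?thesis
          by linarith
      qed
      moreover have "d > 0"
        using d1 d2 d3 by (simp add: d_def)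
      ultimately show "\<exists>d>0. \<forall>h. (\<forall>i. i \<notin> insert j I \<longrightarrow> h $ i = 0) \<longrightarrow> norm h < d \<longrightarrow>
          \<bar>f (x + h) - f x - (\<Sum>i\<in>insert j I. h $ i * partial_deriv i f x)\<bar> \<le> e * norm h"
        by blast
    qed
  qed
  have lin: "bounded_linear (\<lambda>h::real ^ 'n. \<Sum>i\<in>UNIV. h $ i * partial_deriv i f x)"
    by (intro bounded_linear_sum bounded_linear_mult_const bounded_linear_vec_nth)
  show ?thesis
    unfolding has_derivative_at_alt
  proof (intro conjI lin allI impI)
    fix e :: real
    assume "e > 0"
    then obtain d where "d > 0" and d: "\<And>h. norm h < d \<Longrightarrow>
        \<bar>f (x + h) - f x - (\<Sum>i\<in>UNIV. h $ i * partial_deriv i f x)\<bar> \<le> e * norm h"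
      using approx[of UNIV] by auto
    have "norm (f y - f x - (\<Sum>i\<in>UNIV. (y - x) $ i * partial_deriv i f x)) \<le> e * norm (y - x)"
      if "norm (y - x) < d" for y
      using d[OF that] by simp
    with \<open>d > 0\<close> show "\<exists>d>0. \<forall>y. norm (y - x) < d \<longrightarrow>
        norm (f y - f x - (\<Sum>i\<in>UNIV. (y - x) $ i * partial_deriv i f x)) \<le> e * norm (y - x)"
      by blast
  qed
qed

lemma smooth_on_has_real_derivative_line:
  fixes f :: "real ^ 'n \<Rightarrow> real"
  assumes "open S" and "smooth_on S f" and "x + t *\<^sub>R v \<in> S"
  shows "((\<lambda>t. f (x + t *\<^sub>R v)) has_real_derivative
           (\<Sum>i\<in>UNIV. v $ i * partial_deriv i f (x + t *\<^sub>R v))) (at t)"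
proof -
  have "((\<lambda>t. x + t *\<^sub>R v) has_derivative (\<lambda>s. s *\<^sub>R v)) (at t)"
    by (auto intro!: derivative_eq_intros)
  from has_derivative_compose[OF this smooth_on_has_derivative[OF assms]]
  show ?thesis
    unfolding has_field_derivative_def
    by (rule has_derivative_eq_rhs) (simp add: fun_eq_iff sum_distrib_left mult_ac)
qed

section \<open>Convexity along segments\<close>

text \<open>The slope \<open>g'\<close> along the segment is nondecreasing, its derivative being the
  Hessian form at \<open>v\<close>; the mean value theorem writes the increment of \<open>f\<close>
  as some \<open>g' s\<close>, which is at least \<open>g' 0\<close>. Only the segment has to lie in
  \<open>S\<close>, since the punctured space is not convex.\<close>

lemma above_tangent_of_hessian_nonneg:
  fixes f :: "real ^ 'n \<Rightarrow> real"
  assumes "open S" and sm: "smooth_on S f"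
    and hess: "\<And>y w. y \<in> S \<Longrightarrow>
      (\<Sum>i\<in>UNIV. \<Sum>j\<in>UNIV. w $ i * w $ j * partial_deriv i (partial_deriv j f) y) \<ge> 0"
    and seg: "closed_segment y z \<subseteq> S"
  shows "f z \<ge> f y + (\<Sum>i\<in>UNIV. (z - y) $ i * partial_deriv i f y)"
proof -
  define v where "v = z - y"
  define g' where "g' t = (\<Sum>j\<in>UNIV. v $ j * partial_deriv j f (y + t *\<^sub>R v))" for t
  have inS: "y + t *\<^sub>R v \<in> S" if "0 \<le> t" "t \<le> 1" for t
  proof -
    have "y + t *\<^sub>R v = (1 - t) *\<^sub>R y + t *\<^sub>R z"
      by (simp add: v_def algebra_simps)
    then show ?thesis
      using that seg by (auto simp: closed_segment_def)
  qed
  have D1: "((\<lambda>t. f (y + t *\<^sub>R v)) has_real_derivative g' t) (at t)" if "0 \<le> t" "t \<le> 1" for t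
    unfolding g'_def by (rule smooth_on_has_real_derivative_line[OF assms(1) sm inS[OF that]])
  have D2: "\<exists>l. (g' has_real_derivative l) (at t) \<and> 0 \<le> l" if "0 \<le> t" "t \<le> 1" for t
  proof (intro exI conjI)
    let ?l = "\<Sum>j\<in>UNIV. v $ j * (\<Sum>i\<in>UNIV. v $ i * partial_deriv i (partial_deriv j f) (y + t *\<^sub>R v))"
    show "(g' has_real_derivative ?l) (at t)"
      unfolding g'_def
      by (intro DERIV_sum DERIV_cmult smooth_on_has_real_derivative_line[OF assms(1)]
          smooth_on_partial_deriv sm inS that)
    have "?l = (\<Sum>i\<in>UNIV. \<Sum>j\<in>UNIV. v $ i * v $ j * partial_deriv i (partial_deriv j f) (y + t *\<^sub>R v))"
      by (subst sum.swap) (simp add: sum_distrib_left mult_ac)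
    then show "?l \<ge> 0"
      using hess[OF inS[OF that]] by simp
  qed
  obtain s where s: "0 < s" "s < 1" "f (y + 1 *\<^sub>R v) - f (y + 0 *\<^sub>R v) = (1 - 0) * g' s"
    using MVT2[of 0 1 "\<lambda>t. f (y + t *\<^sub>R v)" g'] D1 by auto
  have "g' 0 \<le> g' s"
    by (rule DERIV_nonneg_imp_nondecreasing) (use s D2 in auto)
  with s(3) show ?thesis
    by (simp add: g'_def v_def)
qed

section \<open>Homogeneous functions and Euler's identity\<close>

lemma pos_homogeneous_zero:
  assumes "pos_homogeneous f"
  shows "f 0 = 0"
  \<comment> \<open>Doubling fixes the origin, so \<open>f 0 = 2 * f 0\<close>.\<close>
  using assms[unfolded pos_homogeneous_def, rule_format, of 2 0] by simp

text \<open>Both sides are the derivative at 0 of \<open>f\<close> along the ray through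
  \<open>y\<close>: one by the chain rule, the other by homogeneity with factor
  \<open>1 + t\<close>, which is positive for \<open>t > -1\<close>.\<close>

lemma pos_homogeneous_euler:
  fixes f :: "real ^ 'n \<Rightarrow> real"
  assumes "open S" and "smooth_on S f" and "pos_homogeneous f" and "y \<in> S"
  shows "(\<Sum>i\<in>UNIV. y $ i * partial_deriv i f y) = f y"
proof -
  have D: "((\<lambda>t. f (y + t *\<^sub>R y)) has_real_derivative (\<Sum>i\<in>UNIV. y $ i * partial_deriv i f y)) (at 0)"
    using smooth_on_has_real_derivative_line[OF assms(1,2), of y 0 y] assms(4) by simp
  have "((\<lambda>t. (1 + t) * f y) has_real_derivative f y) (at 0)"
    by (auto intro!: derivative_eq_intros)
  moreover have "f (y + t *\<^sub>R y) = (1 + t) * f y" if "t \<in> {-1<..}" for t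
    using assms(3)[unfolded pos_homogeneous_def, rule_format, of "1 + t" y] that
    by (simp add: algebra_simps)
  ultimately have "((\<lambda>t. f (y + t *\<^sub>R y)) has_real_derivative f y) (at 0)"
    by - (rule has_field_derivative_transform_within_open[where S = "{-1<..}"
          and f = "\<lambda>t. (1 + t) * f y"], auto)
  with D show ?thesis
    by (rule DERIV_unique)
qed

section \<open>The fundamental and triangle inequalities\<close>

lemma fundamental_inequality:
  fixes F :: "real ^ 'n \<Rightarrow> real"
  assumes card: "CARD('n) \<ge> 2"
    and sm: "smooth_on (UNIV - {0}) F"
    and cont: "continuous_on UNIV F"
    and hom: "pos_homogeneous F"
    and hess: "\<And>y w. y \<noteq> 0 \<Longrightarrow>
      (\<Sum>i\<in>UNIV. \<Sum>j\<in>UNIV. w $ i * w $ j * partial_deriv i (partial_deriv j F) y) \<ge> 0"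
    and y: "y \<noteq> 0"
  shows "F z \<ge> (\<Sum>i\<in>UNIV. z $ i * partial_deriv i F y)"
proof -
  define L where "L z = (\<Sum>i\<in>UNIV. z $ i * partial_deriv i F y)" for z
  have op: "open (UNIV - {0 :: real ^ 'n})"
    by (simp add: open_Diff)
  have off: "L z \<le> F z" if "0 \<notin> closed_segment y z" for z
  proof -
    have "F z \<ge> F y + (\<Sum>i\<in>UNIV. (z - y) $ i * partial_deriv i F y)"
      using that hess by (intro above_tangent_of_hessian_nonneg[OF op sm]) auto
    moreover have "L y = F y"
      unfolding L_def using y by (intro pos_homogeneous_euler[OF op sm hom]) auto
    ultimately show ?thesis
      by (simp add: L_def left_diff_distrib sum_subtractf)
  qed
  have "L z \<le> F z"
  proof (cases "0 \<in> closed_segment y z")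
    case False
    then show ?thesis by (rule off)
  next
    case True
    then obtain a where a: "(1 - a) *\<^sub>R y + a *\<^sub>R z = 0"
      by (auto simp: closed_segment_def)
    obtain i where i: "y $ i \<noteq> 0"
      using y by (auto simp: vec_eq_iff)
    have "UNIV \<noteq> {i}"
    proof
      assume "UNIV = {i}"
      from arg_cong[OF this, of card] card show False by simp
    qed
    then obtain j where j: "j \<noteq> i" by blast
    \<comment> \<open>\<open>u\<close> is not parallel to \<open>y\<close>, because
      \<open>u $ i = 0\<close> while \<open>y $ i\<close> is nonzero.\<close>
    define u :: "real ^ 'n" where "u = axis j 1"
    have off_u: "0 \<notin> closed_segment y (z + e *\<^sub>R u)" if "e \<noteq> 0" for e
    proof
      assume "0 \<in> closed_segment y (z + e *\<^sub>R u)"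
      then obtain b where b: "(1 - b) *\<^sub>R y + b *\<^sub>R (z + e *\<^sub>R u) = 0"
        by (auto simp: closed_segment_def)
      have ai: "(1 - a) * y $ k + a * z $ k = 0" for k
        using arg_cong[OF a, of "\<lambda>x. x $ k"] by simp
      have bi: "(1 - b) * y $ k + b * (z $ k + e * u $ k) = 0" for k
        using arg_cong[OF b, of "\<lambda>x. x $ k"] by simp
      have u: "u $ i = 0" "u $ j = 1"
        using j by (auto simp: u_def axis_def)
      have "a \<noteq> 0"
        using ai[of i] i by auto
      have "b \<noteq> 0"
        using bi[of i] i by auto
      \<comment> \<open>This combination eliminates \<open>z $ i\<close> and leaves
        \<open>(a - b) * y $ i\<close>. Once \<open>a = b\<close>, subtracting the two equations in
        coordinate \<open>j\<close> leaves \<open>b * e = 0\<close>.\<close>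
      have "a * ((1 - b) * y $ i + b * z $ i) - b * ((1 - a) * y $ i + a * z $ i) = 0"
        using ai[of i] bi[of i] u by simp
      then have "(a - b) * y $ i = 0"
        by (simp add: algebra_simps)
      then have "a = b"
        using i by simp
      then have "b * e = 0"
        using ai[of j] bi[of j] u by (simp add: algebra_simps)
      then show False
        using \<open>b \<noteq> 0\<close> that by simp
    qed
    have "((\<lambda>e. F (z + e *\<^sub>R u)) \<longlongrightarrow> F (z + 0 *\<^sub>R u)) (at (0::real))"
      using cont by (intro isCont_tendsto_compose[of _ F] tendsto_intros)
        (simp add: continuous_on_eq_continuous_at)
    moreover have "((\<lambda>e. L (z + e *\<^sub>R u)) \<longlongrightarrow> L (z + 0 *\<^sub>R u)) (at (0::real))"
      unfolding L_def by (intro tendsto_intros)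
    \<comment> \<open>\<open>off_u\<close> holds for every nonzero \<open>e\<close>, so the radius 1
      is an arbitrary choice.\<close>
    moreover have "\<forall>\<^sub>F e in at (0::real). L (z + e *\<^sub>R u) \<le> F (z + e *\<^sub>R u)"
      using off[OF off_u] by (auto simp: eventually_at intro!: exI[of _ 1])
    ultimately have "L (z + 0 *\<^sub>R u) \<le> F (z + 0 *\<^sub>R u)"
      by (intro tendsto_le[of "at (0::real)"]) auto
    then show ?thesis by simp
  qed
  then show ?thesis by (simp add: L_def)
qed

theorem proposition2:
  fixes F :: "real ^ 'n \<Rightarrow> real"
  assumes "CARD('n) \<ge> 2"
    and "smooth_on (UNIV - {0}) F"
    and "continuous_on UNIV F"
    and "pos_homogeneous F"
    and "\<forall>y\<in>UNIV - {0}. \<forall>w. (\<Sum>i\<in>UNIV. \<Sum>j\<in>UNIV. w $ i * w $ j * partial_deriv i (partial_deriv j F) y) \<ge> 0"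
  shows "(\<forall>y1 y2. F y1 + F y2 \<ge> F (y1 + y2)) \<and>
         (\<forall>y z. y \<noteq> 0 \<longrightarrow> F z \<ge> (\<Sum>i\<in>UNIV. z $ i * partial_deriv i F y))"
proof -
  have fund: "F z \<ge> (\<Sum>i\<in>UNIV. z $ i * partial_deriv i F y)" if "y \<noteq> 0" for y z
    using assms that by (intro fundamental_inequality) auto
  have euler: "(\<Sum>i\<in>UNIV. y $ i * partial_deriv i F y) = F y" if "y \<noteq> 0" for y
    using that by (intro pos_homogeneous_euler[OF _ assms(2,4)]) (auto simp: open_Diff)
  have "F (y1 + y2) \<le> F y1 + F y2" for y1 y2
  proof (cases "y1 + y2 = 0")
    case False
    have "F (y1 + y2) = (\<Sum>i\<in>UNIV. y1 $ i * partial_deriv i F (y1 + y2)) +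
        (\<Sum>i\<in>UNIV. y2 $ i * partial_deriv i F (y1 + y2))"
      using euler[OF False] by (simp add: distrib_right sum.distrib)
    with fund[OF False, of y1] fund[OF False, of y2] show ?thesis
      by linarith
  next
    case sum0: True
    show ?thesis
    proof (cases "y1 = 0")
      case True
      then show ?thesis
        by (simp add: pos_homogeneous_zero[OF assms(4)])
    next
      case False
      \<comment> \<open>At base point \<open>y1\<close> the linear form sends
        \<open>y2 = - y1\<close> to \<open>- F y1\<close> by Euler's identity.\<close>
      have "y2 = - y1"
        using sum0 by (simp add: eq_neg_iff_add_eq_0 add.commute)
      then have "F y2 \<ge> - F y1"
        using fund[OF False, of y2] euler[OF False] by (simp add: sum_negf)
      then show ?thesis
        using sum0 by (simp add: pos_homogeneous_zero[OF assms(4)])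
    qed
  qed
  with fund show ?thesis by blast
qed

end
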